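(* Let $D=(V,A)$ be a finite connected directed acyclic graph. Then $D$ has at least one topological additive numbering if and only if the following linear program, in the real variables $k$ and $f(v)$ ($v\in V$), is feasible: $$\min\ k \quad\text{subject to}\quad \sum_{w\in N(v)}f(w)-\sum_{w\in N(u)}f(w)\ge 1\ \ \forall (u,v)\in A;\qquad k-f(v)\ge 0\ \ \forall v\in V;\qquad f(v)\ge 1\ \ \forall v\in V.$$
   Context: For a directed acyclic graph $D=(V,A)$, $N(v)$ denotes the set of neighbors of $v$ in the undirected underlying graph of $D$ (both in- and out-neighbors). $\mathbb{N}$ denotes the positive integers. A labeling $f:V\to\mathbb{N}$ is a topological additive numbering of $D$ if, with $S(v)=\sum_{w\in N(v)}f(w)$, one has $S(u)<S(v)$ for every $(u,v)\in A$. *)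

theory Defs
  imports Complex_Main "Graph_Theory.Digraph_Component"
begin

text \<open>
  Digraphs \<open>D = (V, A)\<close> with \<open>A \<subseteq> V \<times> V\<close> are pair digraphs: \<open>V = pverts D\<close>, \<open>A = parcs D\<close>.
  The underlying undirected graph is its symmetric closure \<open>mk_symmetric\<close>; it is also what
  \<open>Digraph_Component.connected\<close> refers to, so that notion is weak connectedness
  (with at least one vertex).
\<close>

definition connected_dag :: "'v pair_pre_digraph \<Rightarrow> bool" where
  "connected_dag D \<longleftrightarrow>
     pair_fin_digraph D \<and> acyclic (parcs D) \<and> Digraph_Component.connected (with_proj D)"

definition neighbors :: "'v pair_pre_digraph \<Rightarrow> 'v \<Rightarrow> 'v set" where
  "neighbors D v = {w. (v, w) \<in> parcs (mk_symmetric (with_proj D))}"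

definition neighbor_sum ::
    "'v pair_pre_digraph \<Rightarrow> ('v \<Rightarrow> 'b::comm_monoid_add) \<Rightarrow> 'v \<Rightarrow> 'b" where
  "neighbor_sum D f v = (\<Sum>w\<in>neighbors D v. f w)"

text \<open>
  Labelings are total functions of which only the values on \<open>pverts D\<close> matter:
  neighbors of vertices are vertices.
\<close>

definition topological_additive_numbering :: "'v pair_pre_digraph \<Rightarrow> ('v \<Rightarrow> nat) \<Rightarrow> bool" where
  "topological_additive_numbering D f \<longleftrightarrow>
     (\<forall>v\<in>pverts D. f v \<ge> 1) \<and>
     (\<forall>(u, v)\<in>parcs D. neighbor_sum D f u < neighbor_sum D f v)"

record 'x minimization_problem =
  objective :: "'x \<Rightarrow> real"
  constraints :: "'x \<Rightarrow> bool"

definition feasible :: "'x minimization_problem \<Rightarrow> bool" where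
  "feasible P \<longleftrightarrow> (\<exists>x. constraints P x)"

definition numbering_lp :: "'v pair_pre_digraph \<Rightarrow> (real \<times> ('v \<Rightarrow> real)) minimization_problem" where
  "numbering_lp D =
     \<lparr> objective = (\<lambda>(k, f). k),
       constraints = (\<lambda>(k, f).
         (\<forall>(u, v)\<in>parcs D. neighbor_sum D f v - neighbor_sum D f u \<ge> 1) \<and>
         (\<forall>v\<in>pverts D. k - f v \<ge> 0) \<and>
         (\<forall>v\<in>pverts D. f v \<ge> 1)) \<rparr>"

end

(* A real solution of the linear program, scaled by N = |V| + 1 and rounded down, is a numbering:
   rounding changes each neighbor sum by at most |V|, while scaling separates the neighbor sums
   along every arc by at least N. *)
theory Submission
  imports Defs
begin

text \<open>This serves two ends: the linear program's bounds on vertices apply to every summand of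
  a neighbor sum, and a neighbor sum has at most |V| terms.\<close>

lemma neighbors_subset_pverts:
  assumes "pair_wf_digraph D"
  shows "neighbors D v \<subseteq> pverts D"
  using assms
  by (auto simp: neighbors_def parcs_mk_symmetric
      dest: pair_wf_digraph.in_arcsD1 pair_wf_digraph.in_arcsD2)

lemma neighbor_sum_of_nat:
  "neighbor_sum D (\<lambda>v. real (f v)) v = real (neighbor_sum D f v)"
  by (simp add: neighbor_sum_def)

text \<open>Each floor never exceeds its argument and loses less than 1, so the losses add up to at
  most the number of terms. If \<open>A\<close> is infinite, the sums and \<open>card A\<close> are
  all 0 by convention.\<close>

lemma sum_floor_bounds:
  fixes g :: "'a \<Rightarrow> real"
  assumes "\<And>w. w \<in> A \<Longrightarrow> g w \<ge> 0"
  shows "real (\<Sum>w\<in>A. nat \<lfloor>g w\<rfloor>) \<le> sum g A"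
    and "sum g A - real (card A) \<le> real (\<Sum>w\<in>A. nat \<lfloor>g w\<rfloor>)"
proof -
  \<comment> \<open>Nonnegativity of \<open>g\<close> keeps \<open>nat\<close> from cutting off a
    negative floor.\<close>
  have eq: "real (\<Sum>w\<in>A. nat \<lfloor>g w\<rfloor>) = (\<Sum>w\<in>A. of_int \<lfloor>g w\<rfloor>)"
    unfolding of_nat_sum using assms by (intro sum.cong) auto
  show "real (\<Sum>w\<in>A. nat \<lfloor>g w\<rfloor>) \<le> sum g A"
    unfolding eq by (intro sum_mono) auto
  have "sum g A - real (card A) = (\<Sum>w\<in>A. g w - 1)"
    by (simp add: sum_subtractf)
  also have "\<dots> \<le> (\<Sum>w\<in>A. of_int \<lfloor>g w\<rfloor>)"
    by (intro sum_mono) linarith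
  finally show "sum g A - real (card A) \<le> real (\<Sum>w\<in>A. nat \<lfloor>g w\<rfloor>)"
    unfolding eq .
qed

lemma feasible_if_topological_additive_numbering:
  assumes fin: "finite (pverts D)" and "topological_additive_numbering D f"
  shows "feasible (numbering_lp D)"
proof -
  have pos: "\<forall>v\<in>pverts D. f v \<ge> 1"
    and less: "\<forall>(u, v)\<in>parcs D. neighbor_sum D f u < neighbor_sum D f v"
    using assms(2) by (simp_all add: topological_additive_numbering_def)
  \<comment> \<open>A strict inequality between natural numbers is a gap of at least 1.\<close>
  have "\<forall>(u, v)\<in>parcs D. real (neighbor_sum D f v) - real (neighbor_sum D f u) \<ge> 1"
    using less by fastforce
  \<comment> \<open>The total of all labels is the witness for \<open>k\<close>. It bounds each
    label because labels are nonnegative, and unlike a maximum it is also defined without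
    vertices.\<close>
  moreover have "\<forall>v\<in>pverts D. real (sum f (pverts D)) - real (f v) \<ge> 0"
    using member_le_sum[OF _ _ fin, of _ f] by (auto simp del: of_nat_sum)
  ultimately have "constraints (numbering_lp D) (real (sum f (pverts D)), \<lambda>v. real (f v))"
    using pos by (simp add: numbering_lp_def neighbor_sum_of_nat del: of_nat_sum)
  then show ?thesis
    unfolding feasible_def by blast
qed

lemma topological_additive_numbering_scaled_floor:
  fixes f :: "'v \<Rightarrow> real"
  assumes D: "pair_fin_digraph D"
    and gap: "\<And>u v. (u, v) \<in> parcs D \<Longrightarrow> neighbor_sum D f v - neighbor_sum D f u \<ge> 1"
    and pos: "\<And>v. v \<in> pverts D \<Longrightarrow> f v \<ge> 1"
  defines "N \<equiv> real (card (pverts D)) + 1"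
  shows "topological_additive_numbering D (\<lambda>v. nat \<lfloor>N * f v\<rfloor>)"
  unfolding topological_additive_numbering_def
proof safe
  interpret pair_fin_digraph D by (rule D)
  have N: "N \<ge> 1"
    by (simp add: N_def)
  \<comment> \<open>Scaling by \<open>N\<close> keeps labels at least 1, so their floors are still
    positive labels.\<close>
  have scaled: "N * f v \<ge> 1" if "v \<in> pverts D" for v
    using mult_mono[OF N pos[OF that]] N by simp
  show "1 \<le> nat \<lfloor>N * f v\<rfloor>" if "v \<in> pverts D" for v
    using scaled[OF that] by linarith
  show "neighbor_sum D (\<lambda>v. nat \<lfloor>N * f v\<rfloor>) u < neighbor_sum D (\<lambda>v. nat \<lfloor>N * f v\<rfloor>) v"
    if uv: "(u, v) \<in> parcs D" for u v
  proof -
    have sub: "neighbors D w \<subseteq> pverts D" for w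
      by (intro neighbors_subset_pverts) unfold_locales
    have nonneg: "N * f w \<ge> 0" if "w \<in> neighbors D x" for w x
      using scaled[of w] sub[of x] that by force
    have sum: "(\<Sum>w\<in>neighbors D x. N * f w) = N * neighbor_sum D f x" for x
      by (simp add: neighbor_sum_def sum_distrib_left)
    \<comment> \<open>At the tail \<open>u\<close> rounding down works in favor of the inequality;
      only the loss at the head \<open>v\<close> has to be absorbed by the gap
      \<open>N\<close>.\<close>
    have "real (neighbor_sum D (\<lambda>v. nat \<lfloor>N * f v\<rfloor>) u) \<le> N * neighbor_sum D f u"
      using sum_floor_bounds(1)[of "neighbors D u" "\<lambda>w. N * f w"] nonneg
      unfolding sum by (simp add: neighbor_sum_def)
    also have "\<dots> \<le> N * neighbor_sum D f v - N"
      using mult_left_mono[OF gap[OF uv], of N] N by (simp add: algebra_simps)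
    \<comment> \<open>The summand 1 in \<open>N\<close> makes this strict even when \<open>v\<close>
      has |V| neighbors.\<close>
    also have "\<dots> < N * neighbor_sum D f v - real (card (neighbors D v))"
      using card_mono[OF finite_verts, of "neighbors D v"] sub[of v] by (simp add: N_def)
    also have "\<dots> \<le> real (neighbor_sum D (\<lambda>v. nat \<lfloor>N * f v\<rfloor>) v)"
      using sum_floor_bounds(2)[of "neighbors D v" "\<lambda>w. N * f w"] nonneg
      unfolding sum by (simp add: neighbor_sum_def)
    finally show ?thesis by simp
  qed
qed

theorem mainTheorem2:
  fixes D :: "'v pair_pre_digraph"
  assumes "connected_dag D"
  shows "(\<exists>f. topological_additive_numbering D f) \<longleftrightarrow> feasible (numbering_lp D)"
proof
  have D: "pair_fin_digraph D"
    using assms by (simp add: connected_dag_def)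
  show "feasible (numbering_lp D)" if "\<exists>f. topological_additive_numbering D f"
    using that feasible_if_topological_additive_numbering pair_fin_digraph.pair_finite_verts[OF D]
    by blast
  show "\<exists>f. topological_additive_numbering D f" if feasible: "feasible (numbering_lp D)"
  proof -
    obtain k f where "constraints (numbering_lp D) (k, f)"
      using feasible by (auto simp: feasible_def)
    then show ?thesis
      using topological_additive_numbering_scaled_floor[OF D, of f]
      by (auto simp: numbering_lp_def)
  qed
qed

end
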